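(* Let $K$ be an algebraically closed field, let $Q$ be a finite quiver and let $\Lambda=KQ/I$ be a finite-dimensional algebra, where $I$ is an ideal of the path algebra $KQ$. Let $C$ be a full convex subquiver of $Q$. Let $e_C$ be the idempotent which is the sum of the trivial-path idempotents at the vertices in $C$, let $e'_C$ be the idempotent which is the sum of the trivial-path idempotents at the vertices of $Q$ not in $C$ (both viewed in $\Lambda$), and let $\langle e'_C\rangle$ be the two-sided ideal of $\Lambda$ generated by $e'_C$. If $\Lambda$ is strongly simply connected, then $\Lambda/\langle e'_C\rangle$ is simply connected.
   Context: All algebras are finite dimensional over an algebraically closed field $K$. A subquiver $C$ of $Q$ is full if for any two vertices $v,w$ of $C$ all arrows of $Q$ from $v$ to $w$ are arrows of $C$. A full subquiver $C$ is convex if for any vertices $v,w$ of $C$ and any path $p$ in $Q$ from $v$ to $w$, every vertex occurring in $p$ is in $C$. A full convex subcategory of $\Lambda=KQ/I$ is an algebra $e_D\Lambda e_D$, where $D$ is a full convex subquiver of $Q$ and $e_D$ is the sum of the trivial-path idempotents at the vertices of $D$. An algebra $A$ is simply connected if its ordinary quiver $Q_A$ has no oriented cycles and, for any presentation $A\cong KQ_A/I_A$ of $A$ as a bound quiver algebra, the fundamental group $\pi_1(Q_A,I_A)$ is trivial. An algebra is strongly simply connected if every full convex subcategory of it is simply connected. The fundamental group of a bound quiver $(Q_A,I_A)$ is the usual one: a relation $\sum_{i=1}^m\lambda_i w_i\in I_A$, with $m\ge 2$, $\lambda_i\in K\setminus\{0\}$ and $w_i$ distinct paths from a common source to a common target,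 is minimal if $\sum_{j\in J}\lambda_j w_j\notin I_A$ for every nonempty proper subset $J\subset\{1,\dots,m\}$. Homotopy is the smallest equivalence relation $\sim$ on walks in $Q_A$ (formal compositions of arrows and formal inverses of arrows) such that: $\alpha\alpha^{-1}\sim e_x$ and $\alpha^{-1}\alpha\sim e_y$ for every arrow $\alpha:x\to y$; $w_i\sim w_j$ for all $i,j$ whenever $\sum_i\lambda_iw_i$ is a minimal relation; and $u\sim v$ implies $wuw'\sim wvw'$ whenever these compositions are defined. Then $\pi_1(Q_A,I_A)$ is the group of homotopy classes of closed walks at a base vertex. *)

theory Defs
  imports
    "HOL-Algebra.Module"
    "HOL-Algebra.QuotRing"
    "HOL-Algebra.Ideal_Product"
    "HOL-Algebra.Elementary_Groups"
    "HOL-Computational_Algebra.Polynomial"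
    "Graph_Theory.Arc_Walk"
    "Graph_Theory.Digraph_Component"
begin

text \<open>
  A quiver is a \<^typ>\<open>('v, 'a) pre_digraph\<close> satisfying \<^const>\<open>wf_digraph\<close>: loops and multiple
  arrows are allowed.  The ground field is a type of class \<^class>\<open>alg_closed_field\<close>; algebras over
  it are records of type \<^typ>\<open>('k, 'b) module\<close> with an explicit carrier.
\<close>


section \<open>Algebras\<close>

definition fin_dim :: "('k::field, 'b) module \<Rightarrow> bool" where
  "fin_dim A \<longleftrightarrow> (\<exists>S. finite S \<and> S \<subseteq> carrier A \<and>
     (\<forall>x\<in>carrier A. \<exists>c. x = (\<Oplus>\<^bsub>A\<^esub>s\<in>S. c s \<odot>\<^bsub>A\<^esub> s)))"

definition alg_iso :: "('k::field, 'b) module \<Rightarrow> ('k, 'c) module \<Rightarrow> bool" where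
  "alg_iso A B \<longleftrightarrow> (\<exists>h\<in>ring_iso A B. \<forall>c. \<forall>x\<in>carrier A. h (c \<odot>\<^bsub>A\<^esub> x) = c \<odot>\<^bsub>B\<^esub> h x)"

definition quot_alg :: "('k::field, 'b) module \<Rightarrow> 'b set \<Rightarrow> ('k, 'b set) module" where
  "quot_alg A J = ring.extend (A Quot J)
     (module.fields (\<lambda>c X. \<Union>x\<in>X. J +>\<^bsub>A\<^esub> (c \<odot>\<^bsub>A\<^esub> x)))"

definition corner_alg :: "('k::field, 'b) module \<Rightarrow> 'b \<Rightarrow> ('k, 'b) module" where
  "corner_alg A e = A\<lparr>carrier := {e \<otimes>\<^bsub>A\<^esub> x \<otimes>\<^bsub>A\<^esub> e | x. x \<in> carrier A}, one := e\<rparr>"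

definition right_ideal :: "'b set \<Rightarrow> ('k::field, 'b) module \<Rightarrow> bool" where
  "right_ideal J A \<longleftrightarrow> additive_subgroup J A \<and> (\<forall>x\<in>J. \<forall>a\<in>carrier A. x \<otimes>\<^bsub>A\<^esub> a \<in> J)"

definition maximal_right_ideal :: "'b set \<Rightarrow> ('k::field, 'b) module \<Rightarrow> bool" where
  "maximal_right_ideal M A \<longleftrightarrow> right_ideal M A \<and> M \<noteq> carrier A \<and>
     (\<forall>J. right_ideal J A \<longrightarrow> M \<subseteq> J \<longrightarrow> J = M \<or> J = carrier A)"

definition jacobson_radical :: "('k::field, 'b) module \<Rightarrow> 'b set" where
  "jacobson_radical A = {x \<in> carrier A. \<forall>M. maximal_right_ideal M A \<longrightarrow> x \<in> M}"

primrec ideal_power :: "('k::field, 'b) module \<Rightarrow> 'b set \<Rightarrow> nat \<Rightarrow> 'b set" where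
  "ideal_power A J 0 = carrier A"
| "ideal_power A J (Suc n) = ideal_prod A (ideal_power A J n) J"

definition idempotent_of :: "('k::field, 'b) module \<Rightarrow> 'b \<Rightarrow> bool" where
  "idempotent_of A e \<longleftrightarrow> e \<in> carrier A \<and> e \<otimes>\<^bsub>A\<^esub> e = e"

definition orthogonal_in :: "('k::field, 'b) module \<Rightarrow> 'b \<Rightarrow> 'b \<Rightarrow> bool" where
  "orthogonal_in A e f \<longleftrightarrow> e \<otimes>\<^bsub>A\<^esub> f = \<zero>\<^bsub>A\<^esub> \<and> f \<otimes>\<^bsub>A\<^esub> e = \<zero>\<^bsub>A\<^esub>"

definition primitive_idempotent :: "('k::field, 'b) module \<Rightarrow> 'b \<Rightarrow> bool" where
  "primitive_idempotent A e \<longleftrightarrow> idempotent_of A e \<and> e \<noteq> \<zero>\<^bsub>A\<^esub> \<and>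
     (\<forall>f g. idempotent_of A f \<longrightarrow> idempotent_of A g \<longrightarrow> orthogonal_in A f g \<longrightarrow>
        e = f \<oplus>\<^bsub>A\<^esub> g \<longrightarrow> f = \<zero>\<^bsub>A\<^esub> \<or> g = \<zero>\<^bsub>A\<^esub>)"

text \<open>The right modules \<open>eA\<close> and \<open>fA\<close> are isomorphic.\<close>

definition right_proj_iso :: "('k::field, 'b) module \<Rightarrow> 'b \<Rightarrow> 'b \<Rightarrow> bool" where
  "right_proj_iso A e f \<longleftrightarrow>
     (let P = (\<lambda>x. e \<otimes>\<^bsub>A\<^esub> x) ` carrier A; R = (\<lambda>x. f \<otimes>\<^bsub>A\<^esub> x) ` carrier A in
      \<exists>\<phi>. bij_betw \<phi> P R \<and>
        (\<forall>x\<in>P. \<forall>y\<in>P. \<phi> (x \<oplus>\<^bsub>A\<^esub> y) = \<phi> x \<oplus>\<^bsub>A\<^esub> \<phi> y) \<and>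
        (\<forall>x\<in>P. \<forall>a\<in>carrier A. \<phi> (x \<otimes>\<^bsub>A\<^esub> a) = \<phi> x \<otimes>\<^bsub>A\<^esub> a))"


section \<open>Path algebras and bound quiver algebras\<close>

text \<open>
  The triple \<open>(u, p, v)\<close> stands for the path with arrows \<open>p\<close> from \<open>u\<close> to \<open>v\<close>; in particular
  \<open>(u, [], u)\<close> is the trivial path at \<open>u\<close>.  Paths are composed from left to right.
\<close>

type_synonym ('v, 'a) qpath = "'v \<times> 'a list \<times> 'v"

definition qpaths :: "('v, 'a) pre_digraph \<Rightarrow> ('v, 'a) qpath set" where
  "qpaths Q = {(u, p, v). pre_digraph.awalk Q u p v}"

definition src :: "('v, 'a) qpath \<Rightarrow> 'v" where "src \<pi> = fst \<pi>"
definition trg :: "('v, 'a) qpath \<Rightarrow> 'v" where "trg \<pi> = snd (snd \<pi>)"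

definition pcomp :: "('v, 'a) qpath \<Rightarrow> ('v, 'a) qpath \<Rightarrow> ('v, 'a) qpath" where
  "pcomp \<pi> \<rho> = (src \<pi>, fst (snd \<pi>) @ fst (snd \<rho>), trg \<rho>)"

text \<open>
  Elements of the path algebra are the finitely supported coefficient functions on paths.  The
  product of basis paths is their composite if it exists and zero otherwise, so a coefficient of a
  product is a sum over the (finitely many) factorisations of a path.
\<close>

definition path_algebra :: "('v, 'a) pre_digraph \<Rightarrow> ('k::field, ('v, 'a) qpath \<Rightarrow> 'k) module" where
  "path_algebra Q =
    \<lparr>carrier = {f. finite {\<pi>. f \<pi> \<noteq> 0} \<and> {\<pi>. f \<pi> \<noteq> 0} \<subseteq> qpaths Q},
     monoid.mult = (\<lambda>f g \<tau>. \<Sum>(\<pi>, \<rho>) \<in> {(\<pi>, \<rho>). \<pi> \<in> qpaths Q \<and> \<rho> \<in> qpaths Q \<and> trg \<pi> = src \<rho> \<and>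
                                          pcomp \<pi> \<rho> = \<tau>}. f \<pi> * g \<rho>),
     one = (\<lambda>\<tau>. if \<exists>v\<in>verts Q. \<tau> = (v, [], v) then 1 else 0),
     zero = (\<lambda>\<tau>. 0),
     add = (\<lambda>f g \<tau>. f \<tau> + g \<tau>),
     module.smult = (\<lambda>c f \<tau>. c * f \<tau>)\<rparr>"

definition basis_path :: "('v, 'a) qpath \<Rightarrow> ('v, 'a) qpath \<Rightarrow> 'k::field" where
  "basis_path \<pi> = (\<lambda>\<tau>. if \<tau> = \<pi> then 1 else 0)"

definition bound_quiver_algebra ::
    "('v, 'a) pre_digraph \<Rightarrow> (('v, 'a) qpath \<Rightarrow> 'k::field) set \<Rightarrow>
     ('k, (('v, 'a) qpath \<Rightarrow> 'k) set) module" where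
  "bound_quiver_algebra Q I = quot_alg (path_algebra Q) I"

text \<open>The sum, in \<open>KQ/I\<close>, of the trivial-path idempotents at the vertices in \<open>V\<close>.\<close>

definition vertex_idem ::
    "('v, 'a) pre_digraph \<Rightarrow> (('v, 'a) qpath \<Rightarrow> 'k::field) set \<Rightarrow> 'v set \<Rightarrow>
     (('v, 'a) qpath \<Rightarrow> 'k) set" where
  "vertex_idem Q I V =
     (\<Oplus>\<^bsub>bound_quiver_algebra Q I\<^esub>v\<in>V. I +>\<^bsub>path_algebra Q\<^esub> basis_path (v, [], v))"

definition arrow_ideal :: "('v, 'a) pre_digraph \<Rightarrow> (('v, 'a) qpath \<Rightarrow> 'k::field) set" where
  "arrow_ideal Q = genideal (path_algebra Q)
     ((\<lambda>\<alpha>. basis_path (tail Q \<alpha>, [\<alpha>], head Q \<alpha>)) ` arcs Q)"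

definition admissible :: "('v, 'a) pre_digraph \<Rightarrow> (('v, 'a) qpath \<Rightarrow> 'k::field) set \<Rightarrow> bool" where
  "admissible Q I \<longleftrightarrow> ideal I (path_algebra Q) \<and>
     I \<subseteq> ideal_power (path_algebra Q) (arrow_ideal Q) 2 \<and>
     (\<exists>m\<ge>2. ideal_power (path_algebra Q) (arrow_ideal Q) m \<subseteq> I)"


section \<open>Ordinary quivers and presentations\<close>

text \<open>
  \<open>Q\<close> is the ordinary quiver of the basic algebra \<open>A\<close>: its vertices index a complete set of
  primitive orthogonal idempotents \<open>\<epsilon> v\<close>, and its arrows from \<open>v\<close> to \<open>w\<close> index elements \<open>\<xi> \<alpha>\<close> whose
  classes form a basis of \<open>\<epsilon>\<^sub>v (rad A / rad\<^sup>2 A) \<epsilon>\<^sub>w\<close>.  The pairwise non-isomorphism of the modules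
  \<open>\<epsilon>\<^sub>v A\<close> says that \<open>A\<close> is basic; an algebra that is not basic has no ordinary quiver here.
\<close>

definition ordinary_quiver :: "('v, 'a) pre_digraph \<Rightarrow> ('k::field, 'b) module \<Rightarrow> bool" where
  "ordinary_quiver Q A \<longleftrightarrow> fin_digraph Q \<and> (\<exists>\<epsilon> \<xi>.
     (\<forall>v\<in>verts Q. primitive_idempotent A (\<epsilon> v)) \<and>
     (\<forall>v\<in>verts Q. \<forall>w\<in>verts Q. v \<noteq> w \<longrightarrow> orthogonal_in A (\<epsilon> v) (\<epsilon> w)) \<and>
     (\<Oplus>\<^bsub>A\<^esub>v\<in>verts Q. \<epsilon> v) = \<one>\<^bsub>A\<^esub> \<and>
     (\<forall>v\<in>verts Q. \<forall>w\<in>verts Q. v \<noteq> w \<longrightarrow> \<not> right_proj_iso A (\<epsilon> v) (\<epsilon> w)) \<and>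
     (\<forall>v\<in>verts Q. \<forall>w\<in>verts Q.
        let arrows = {\<alpha>\<in>arcs Q. tail Q \<alpha> = v \<and> head Q \<alpha> = w};
            piece = {\<epsilon> v \<otimes>\<^bsub>A\<^esub> r \<otimes>\<^bsub>A\<^esub> \<epsilon> w | r. r \<in> jacobson_radical A} in
        (\<forall>\<alpha>\<in>arrows. \<xi> \<alpha> \<in> piece) \<and>
        (\<forall>y\<in>piece. \<exists>!c. c \<in> arrows \<rightarrow>\<^sub>E UNIV \<and>
           y \<ominus>\<^bsub>A\<^esub> (\<Oplus>\<^bsub>A\<^esub>\<alpha>\<in>arrows. c \<alpha> \<odot>\<^bsub>A\<^esub> \<xi> \<alpha>) \<in> ideal_power A (jacobson_radical A) 2)))"

definition presentation ::
    "('v, 'a) pre_digraph \<Rightarrow> (('v, 'a) qpath \<Rightarrow> 'k::field) set \<Rightarrow> ('k, 'b) module \<Rightarrow> bool" where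
  "presentation Q I A \<longleftrightarrow>
     ordinary_quiver Q A \<and> admissible Q I \<and> alg_iso A (bound_quiver_algebra Q I)"

definition no_oriented_cycles :: "('v, 'a) pre_digraph \<Rightarrow> bool" where
  "no_oriented_cycles Q \<longleftrightarrow> \<not> (\<exists>u p. p \<noteq> [] \<and> pre_digraph.awalk Q u p u)"


section \<open>The fundamental group of a bound quiver\<close>

datatype 'a letter = Fwd 'a | Bwd 'a

definition double_quiver :: "('v, 'a) pre_digraph \<Rightarrow> ('v, 'a letter) pre_digraph" where
  "double_quiver Q =
    \<lparr>verts = verts Q,
     arcs = Fwd ` arcs Q \<union> Bwd ` arcs Q,
     tail = case_letter (tail Q) (head Q),
     head = case_letter (head Q) (tail Q)\<rparr>"

text \<open>Walks in \<open>Q\<close> are the paths of its double quiver.\<close>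

abbreviation qwalks :: "('v, 'a) pre_digraph \<Rightarrow> ('v, 'a letter) qpath set" where
  "qwalks Q \<equiv> qpaths (double_quiver Q)"

definition walk_of_path :: "('v, 'a) qpath \<Rightarrow> ('v, 'a letter) qpath" where
  "walk_of_path \<pi> = (src \<pi>, map Fwd (fst (snd \<pi>)), trg \<pi>)"

text \<open>
  A relation \<open>\<Sum>\<^sub>i \<lambda>\<^sub>i w\<^sub>i\<close> is its coefficient function \<open>r\<close>: the paths \<open>w\<^sub>i\<close> form the support of \<open>r\<close>, and
  a subsum is a restriction of \<open>r\<close> to a subset of the support.
\<close>

definition minimal_relation ::
    "(('v, 'a) qpath \<Rightarrow> 'k::field) set \<Rightarrow> (('v, 'a) qpath \<Rightarrow> 'k) \<Rightarrow> bool" where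
  "minimal_relation I r \<longleftrightarrow>
     (let W = {\<pi>. r \<pi> \<noteq> 0} in
      r \<in> I \<and> finite W \<and> 2 \<le> card W \<and>
      (\<exists>x y. \<forall>\<pi>\<in>W. src \<pi> = x \<and> trg \<pi> = y) \<and>
      (\<forall>J. J \<noteq> {} \<longrightarrow> J \<subset> W \<longrightarrow> (\<lambda>\<pi>. if \<pi> \<in> J then r \<pi> else 0) \<notin> I))"

inductive homotopic ::
    "('v, 'a) pre_digraph \<Rightarrow> (('v, 'a) qpath \<Rightarrow> 'k::field) set \<Rightarrow>
     ('v, 'a letter) qpath \<Rightarrow> ('v, 'a letter) qpath \<Rightarrow> bool"
  for Q I where
  refl: "w \<in> qwalks Q \<Longrightarrow> homotopic Q I w w"
| sym: "homotopic Q I u v \<Longrightarrow> homotopic Q I v u"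
| trans: "homotopic Q I u v \<Longrightarrow> homotopic Q I v w \<Longrightarrow> homotopic Q I u w"
| fwd_bwd: "\<alpha> \<in> arcs Q \<Longrightarrow>
    homotopic Q I (tail Q \<alpha>, [Fwd \<alpha>, Bwd \<alpha>], tail Q \<alpha>) (tail Q \<alpha>, [], tail Q \<alpha>)"
| bwd_fwd: "\<alpha> \<in> arcs Q \<Longrightarrow>
    homotopic Q I (head Q \<alpha>, [Bwd \<alpha>, Fwd \<alpha>], head Q \<alpha>) (head Q \<alpha>, [], head Q \<alpha>)"
| relation: "minimal_relation I r \<Longrightarrow> r \<pi> \<noteq> 0 \<Longrightarrow> r \<rho> \<noteq> 0 \<Longrightarrow>
    homotopic Q I (walk_of_path \<pi>) (walk_of_path \<rho>)"
| cong: "homotopic Q I u v \<Longrightarrow> w \<in> qwalks Q \<Longrightarrow> w' \<in> qwalks Q \<Longrightarrow>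
    trg w = src u \<Longrightarrow> trg u = src w' \<Longrightarrow> trg w = src v \<Longrightarrow> trg v = src w' \<Longrightarrow>
    homotopic Q I (pcomp (pcomp w u) w') (pcomp (pcomp w v) w')"

definition fundamental_group ::
    "('v, 'a) pre_digraph \<Rightarrow> (('v, 'a) qpath \<Rightarrow> 'k::field) set \<Rightarrow> 'v \<Rightarrow>
     ('v, 'a letter) qpath set monoid" where
  "fundamental_group Q I x =
    \<lparr>carrier = {w \<in> qwalks Q. src w = x \<and> trg w = x} // {(u, v). homotopic Q I u v},
     monoid.mult = (\<lambda>X Y. \<Union>u\<in>X. \<Union>v\<in>Y. {w. homotopic Q I (pcomp u v) w}),
     one = {w. homotopic Q I (x, [], x) w}\<rparr>"


section \<open>Simple connectedness\<close>

text \<open>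
  A basic algebra determines its ordinary quiver up to isomorphism, and a finite quiver is isomorphic
  to one whose vertices and arrows are natural numbers, so only those are considered.  Algebras need
  not be connected, hence all base points are taken into account.
\<close>

definition simply_connected :: "('k::field, 'b) module \<Rightarrow> bool" where
  "simply_connected A \<longleftrightarrow>
     (\<exists>Q :: (nat, nat) pre_digraph. ordinary_quiver Q A \<and> no_oriented_cycles Q) \<and>
     (\<forall>(Q :: (nat, nat) pre_digraph) I. presentation Q I A \<longrightarrow>
        (\<forall>x\<in>verts Q. trivial_group (fundamental_group Q I x)))"

definition full_convex_subquiver :: "('v, 'a) pre_digraph \<Rightarrow> ('v, 'a) pre_digraph \<Rightarrow> bool" where
  "full_convex_subquiver C Q \<longleftrightarrow> induced_subgraph C Q \<and>
     (\<forall>v\<in>verts C. \<forall>w\<in>verts C. \<forall>p. pre_digraph.awalk Q v p w \<longrightarrow>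
        set (pre_digraph.awalk_verts Q v p) \<subseteq> verts C)"

text \<open>Full convex subcategories are formed with respect to the given quiver \<open>Q\<close> of \<open>\<Lambda> = KQ/I\<close>.\<close>

definition strongly_simply_connected ::
    "('v, 'a) pre_digraph \<Rightarrow> (('v, 'a) qpath \<Rightarrow> 'k::field) set \<Rightarrow> bool" where
  "strongly_simply_connected Q I \<longleftrightarrow>
     (\<forall>D. full_convex_subquiver D Q \<longrightarrow>
        simply_connected (corner_alg (bound_quiver_algebra Q I) (vertex_idem Q I (verts D))))"

end

theory Submission
  imports Defs "HOL-Algebra.Multiplicative_Group"
begin

text \<open>
  A path between two vertices of the convex subquiver \<open>C\<close> never leaves \<open>C\<close>, so
  \<open>e\<^sub>C \<Lambda> e'\<^sub>C \<Lambda> e\<^sub>C = 0\<close>.  Hence \<open>\<langle>e'\<^sub>C\<rangle>\<close> meets \<open>e\<^sub>C \<Lambda> e\<^sub>C\<close> trivially, while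
  \<open>\<Lambda> = e\<^sub>C \<Lambda> e\<^sub>C + \<langle>e'\<^sub>C\<rangle>\<close> because \<open>e\<^sub>C + e'\<^sub>C = 1\<close>.  The quotient is therefore isomorphic to the full
  convex subcategory \<open>e\<^sub>C \<Lambda> e\<^sub>C\<close>, which is simply connected by hypothesis.
\<close>

section \<open>Algebras, quotients and corners\<close>

text \<open>Each scalar acts as an additive operator that commutes with left and right
  multiplication. These are the laws that the passage to quotients and corners has to
  preserve.\<close>

locale k_algebra = ring A for A :: "('k::field, 'b) module" (structure) +
  assumes smult_closed [simp, intro]: "x \<in> carrier A \<Longrightarrow> c \<odot> x \<in> carrier A"
    and smult_add: "x \<in> carrier A \<Longrightarrow> y \<in> carrier A \<Longrightarrow> c \<odot> (x \<oplus> y) = c \<odot> x \<oplus> c \<odot> y"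
    and smult_mult: "x \<in> carrier A \<Longrightarrow> y \<in> carrier A \<Longrightarrow> (c \<odot> x) \<otimes> y = c \<odot> (x \<otimes> y)"
    and mult_smult: "x \<in> carrier A \<Longrightarrow> y \<in> carrier A \<Longrightarrow> x \<otimes> (c \<odot> y) = c \<odot> (x \<otimes> y)"

lemma quot_alg_sel:
  "carrier (quot_alg A J) = carrier (A Quot J)"
  "monoid.mult (quot_alg A J) = monoid.mult (A Quot J)"
  "one (quot_alg A J) = one (A Quot J)"
  "zero (quot_alg A J) = zero (A Quot J)"
  "add (quot_alg A J) = add (A Quot J)"
  "c \<odot>\<^bsub>quot_alg A J\<^esub> X = (\<Union>x\<in>X. J +>\<^bsub>A\<^esub> (c \<odot>\<^bsub>A\<^esub> x))"
  by (simp_all add: quot_alg_def ring.defs module.defs)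

text \<open>\<open>quot_alg\<close> extends the record of the quotient ring by a scalar
  multiplication, so the identity map is a ring isomorphism onto it and transports the ring
  axioms.\<close>

lemma ring_quot_alg:
  assumes "ideal J A"
  shows "ring (quot_alg A J)"
proof -
  interpret ideal J A by fact
  interpret Q: ring "A Quot J" by (rule quotient_is_ring)
  have "id \<in> ring_iso (A Quot J) (quot_alg A J)"
    by (rule ring_iso_memI) (auto simp: quot_alg_sel)
  \<comment> \<open>The transport rule resets \<open>zero\<close> to the image of the old zero; here
    this update leaves the record unchanged.\<close>
  then have "ring ((quot_alg A J)\<lparr>zero := id \<zero>\<^bsub>A Quot J\<^esub>\<rparr>)"
    by (rule Q.ring_iso_imp_img_ring)
  moreover have "(quot_alg A J)\<lparr>zero := id \<zero>\<^bsub>A Quot J\<^esub>\<rparr> = quot_alg A J"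
    by (simp add: quot_alg_sel(4)[symmetric])
  ultimately show ?thesis by simp
qed

lemma rcos_ring_hom_quot_alg:
  assumes "ideal J A"
  shows "ring_hom_ring A (quot_alg A J) ((+>\<^bsub>A\<^esub>) J)"
proof -
  interpret ideal J A by fact
  from rcos_ring_hom have "(+>\<^bsub>A\<^esub>) J \<in> ring_hom A (quot_alg A J)"
    by (simp add: ring_hom_def quot_alg_sel)
  then show ?thesis
    by (intro ring_hom_ringI2 ring_quot_alg[OF assms] ring_axioms)
qed

lemma carrier_quot_alg: "carrier (quot_alg A J) = (\<lambda>x. J +>\<^bsub>A\<^esub> x) ` carrier A"
  by (auto simp: quot_alg_sel FactRing_simps)

context k_algebra
begin

text \<open>Scaling by \<open>c\<close> is left multiplication by \<open>c \<odot> \<one>\<close>,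
  so every two-sided ideal of the ring is automatically stable under scalars.\<close>

lemma ideal_smult_closed:
  assumes "ideal J A" "x \<in> J"
  shows "c \<odot> x \<in> J"
proof -
  interpret J: ideal J A by fact
  have "(c \<odot> \<one>) \<otimes> x \<in> J" using assms(2) by (intro J.I_l_closed) auto
  then show ?thesis using assms(2) by (simp add: smult_mult J.Icarr)
qed

text \<open>The scalar multiplication of the quotient is a union over all representatives of a
  coset. Since \<open>J\<close> is stable under scalars, all cosets in that union coincide, so one
  representative suffices.\<close>

lemma quot_alg_smult:
  assumes "ideal J A" "x \<in> carrier A"
  shows "c \<odot>\<^bsub>quot_alg A J\<^esub> (J +> x) = J +> (c \<odot> x)"
proof -
  interpret J: ideal J A by fact
  have "J +> (c \<odot> y) = J +> (c \<odot> x)" if "y \<in> J +> x" for y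
  proof -
    from that obtain j where j: "j \<in> J" "y = j \<oplus> x"
      by (auto simp: a_r_coset_def')
    then have "c \<odot> y = c \<odot> j \<oplus> c \<odot> x"
      using assms(2) J.Icarr smult_add by blast
    then have "c \<odot> y \<in> J +> (c \<odot> x)"
      using ideal_smult_closed[OF assms(1) j(1)] by (auto simp: a_r_coset_def')
    then show ?thesis using J.a_repr_independence' smult_closed[OF assms(2)] by metis
  qed
  moreover have "x \<in> J +> x" using assms(2) by (rule J.a_rcos_self)
  ultimately show ?thesis unfolding quot_alg_sel by blast
qed

lemma quot_alg_k_algebra:
  assumes "ideal J A"
  shows "k_algebra (quot_alg A J)"
proof -
  interpret \<pi>: ring_hom_ring A "quot_alg A J" "(+>) J" by (rule rcos_ring_hom_quot_alg[OF assms])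
  show ?thesis
    by (intro k_algebra.intro k_algebra_axioms.intro ring_quot_alg assms)
      (auto simp: carrier_quot_alg quot_alg_smult[OF assms] smult_add smult_mult mult_smult
         simp flip: \<pi>.hom_add \<pi>.hom_mult)
qed

section \<open>Corner algebras and their comparison with quotients\<close>

text \<open>Because \<open>e\<close> is idempotent, the corner consists exactly of the
  \<open>x\<close> with \<open>e \<otimes> x \<otimes> e = x\<close>. All closure properties are
  checked through this fixed-point equation, and \<open>e\<close> becomes the unit.\<close>

lemma corner_k_algebra:
  assumes e: "e \<in> carrier A" and ee: "e \<otimes> e = e"
  shows "k_algebra (corner_alg A e)"
proof -
  define S where "S = {e \<otimes> x \<otimes> e | x. x \<in> carrier A}"
  have sel: "carrier (corner_alg A e) = S" "monoid.mult (corner_alg A e) = (\<otimes>)"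
    "\<one>\<^bsub>corner_alg A e\<^esub> = e" "\<zero>\<^bsub>corner_alg A e\<^esub> = \<zero>" "add (corner_alg A e) = (\<oplus>)"
    "module.smult (corner_alg A e) = (\<odot>)"
    by (simp_all add: corner_alg_def S_def)
  have car: "x \<in> carrier A" if "x \<in> S" for x using that e by (auto simp: S_def)
  have left: "e \<otimes> x = x" and right: "x \<otimes> e = x" if "x \<in> S" for x
  proof -
    from that obtain y where y: "y \<in> carrier A" "x = e \<otimes> y \<otimes> e" by (auto simp: S_def)
    have "e \<otimes> x = (e \<otimes> e) \<otimes> y \<otimes> e" using y e by (simp add: m_assoc)
    then show "e \<otimes> x = x" using y ee by simp
    have "x \<otimes> e = e \<otimes> y \<otimes> (e \<otimes> e)" using y e by (simp add: m_assoc)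
    then show "x \<otimes> e = x" using y ee by simp
  qed
  have memI: "x \<in> S" if "x \<in> carrier A" "e \<otimes> x \<otimes> e = x" for x
    using that unfolding S_def by (intro CollectI exI[of _ x]) simp
  have add_S: "x \<oplus> y \<in> S" if "x \<in> S" "y \<in> S" for x y
    using car[OF that(1)] car[OF that(2)] left[OF that(1)] left[OF that(2)]
      right[OF that(1)] right[OF that(2)] e
    by (intro memI) (simp_all add: l_distr r_distr)
  have mult_S: "x \<otimes> y \<in> S" if "x \<in> S" "y \<in> S" for x y
    using car[OF that(1)] car[OF that(2)] left[OF that(1)] right[OF that(2)] e
    by (intro memI) (simp_all add: m_assoc flip: m_assoc[of e x])
  have minus_S: "\<ominus> x \<in> S" if "x \<in> S" for x
    using car[OF that] left[OF that] right[OF that] e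
    by (intro memI) (simp_all add: l_minus r_minus)
  have smult_S: "c \<odot> x \<in> S" if "x \<in> S" for x c
    using car[OF that] left[OF that] right[OF that] e
    by (intro memI) (simp_all add: mult_smult smult_mult)
  have zero_S: "\<zero> \<in> S" using e by (intro memI) auto
  have one_S: "e \<in> S" using e ee by (intro memI) auto
  show ?thesis
  proof (intro k_algebra.intro k_algebra_axioms.intro)
    show "ring (corner_alg A e)"
    proof (rule ringI)
      show "abelian_group (corner_alg A e)"
      proof (rule abelian_groupI)
        fix x assume "x \<in> carrier (corner_alg A e)"
        then show "\<exists>y\<in>carrier (corner_alg A e). y \<oplus>\<^bsub>corner_alg A e\<^esub> x = \<zero>\<^bsub>corner_alg A e\<^esub>"
          unfolding sel by (intro bexI[of _ "\<ominus> x"]) (auto intro: minus_S l_neg car)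
      qed (auto simp: sel a_assoc add_S zero_S car intro: a_comm)
      show "Group.monoid (corner_alg A e)"
        by (rule monoidI) (auto simp: sel m_assoc mult_S one_S car left right)
    qed (auto simp: sel l_distr r_distr car)
  qed (auto simp: sel smult_S smult_add smult_mult mult_smult car)
qed

text \<open>The isomorphism is the quotient map restricted to the corner. Premise
  \<open>orth\<close> states \<open>e A e' A e = 0\<close>, the algebraic form of convexity; it
  gives injectivity, while \<open>sum1\<close> gives surjectivity.\<close>

lemma corner_iso_quotient:
  assumes e: "e \<in> carrier A" and e': "e' \<in> carrier A"
    and sum1: "e \<oplus> e' = \<one>" and ee': "e \<otimes> e' = \<zero>"
    and orth: "\<And>x y. x \<in> carrier A \<Longrightarrow> y \<in> carrier A \<Longrightarrow> (e \<otimes> x) \<otimes> (e' \<otimes> (y \<otimes> e)) = \<zero>"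
  shows "k_algebra (corner_alg A e)"
    and "alg_iso (corner_alg A e) (quot_alg A (genideal A {e'}))"
proof -
  \<comment> \<open>Multiply \<open>e \<oplus> e' = \<one>\<close> by \<open>e\<close> on the left;
    the second summand vanishes by \<open>ee'\<close>.\<close>
  have ee: "e \<otimes> e = e"
    using e e' ee' sum1 r_distr[of e e' e] by (simp add: r_one)
  then show "k_algebra (corner_alg A e)" by (rule corner_k_algebra[OF e])
  define J where "J = genideal A {e'}"
  have J: "ideal J A" unfolding J_def using e' by (intro genideal_ideal) auto
  interpret J: ideal J A by fact
  interpret \<pi>: ring_hom_ring A "quot_alg A J" "(+>) J" by (rule rcos_ring_hom_quot_alg[OF J])
  \<comment> \<open>The elements \<open>z\<close> with \<open>e A z A e = 0\<close> form an ideal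
    containing \<open>e'\<close>. Minimality of the generated ideal then yields
    \<open>J \<subseteq> N\<close> without writing elements of \<open>J\<close> as finite sums of
    products.\<close>
  define N where "N = {z \<in> carrier A. \<forall>x\<in>carrier A. \<forall>y\<in>carrier A. (e \<otimes> x) \<otimes> (z \<otimes> (y \<otimes> e)) = \<zero>}"
  have "ideal N A"
  proof (rule idealI)
    show "ring A" by (rule ring_axioms)
    show "subgroup N (add_monoid A)"
      by (rule add.subgroupI)
        (use e in \<open>auto simp: N_def l_distr r_distr l_minus r_minus a_inv_def[symmetric]\<close>)
  next
    fix z w assume z: "z \<in> N" and w: "w \<in> carrier A"
    then have zc: "z \<in> carrier A" by (simp add: N_def)
    have "(e \<otimes> x) \<otimes> (w \<otimes> z \<otimes> (y \<otimes> e)) = (e \<otimes> (x \<otimes> w)) \<otimes> (z \<otimes> (y \<otimes> e))"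
      "(e \<otimes> x) \<otimes> (z \<otimes> w \<otimes> (y \<otimes> e)) = (e \<otimes> x) \<otimes> (z \<otimes> ((w \<otimes> y) \<otimes> e))"
      if "x \<in> carrier A" "y \<in> carrier A" for x y
      using that zc w e by (simp_all add: m_assoc)
    then show "w \<otimes> z \<in> N" "z \<otimes> w \<in> N"
      using z w by (auto simp: N_def)
  qed
  moreover have "{e'} \<subseteq> N" using orth e' by (auto simp: N_def)
  ultimately have JN: "J \<subseteq> N" unfolding J_def by (rule genideal_minimal)
  have e'J: "e' \<in> J" unfolding J_def using e' by (rule genideal_self')
  let ?S = "carrier (corner_alg A e)"
  have S: "?S = {e \<otimes> x \<otimes> e | x. x \<in> carrier A}" by (simp add: corner_alg_def)
  have car: "x \<in> carrier A" if "x \<in> ?S" for x using that e by (auto simp: S)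
  have fixS: "e \<otimes> x \<otimes> e = x" if "x \<in> ?S" for x
  proof -
    from that obtain y where y: "y \<in> carrier A" "x = e \<otimes> y \<otimes> e" by (auto simp: S)
    have "e \<otimes> x \<otimes> e = (e \<otimes> e) \<otimes> y \<otimes> (e \<otimes> e)" using y e by (simp add: m_assoc)
    then show ?thesis using y ee by simp
  qed
  \<comment> \<open>Membership in \<open>N\<close>, tested at \<open>x = y = \<one>\<close>, says
    that \<open>e z e\<close> is zero, and a corner element equals its own \<open>e z e\<close>. So
    \<open>J\<close> meets the corner only in zero.\<close>
  have zero: "z = \<zero>" if "z \<in> J" "e \<otimes> z \<otimes> e = z" for z
  proof -
    have "(e \<otimes> \<one>) \<otimes> (z \<otimes> (\<one> \<otimes> e)) = \<zero>" using that JN by (auto simp: N_def)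
    then show ?thesis using that J.Icarr e by (simp add: m_assoc)
  qed
  have inj: "inj_on ((+>) J) ?S"
  proof (rule inj_onI)
    fix x y assume xy: "x \<in> ?S" "y \<in> ?S" "J +> x = J +> y"
    have c: "x \<in> carrier A" "y \<in> carrier A" using xy car by auto
    then have "x \<ominus> y \<in> J" using xy(3) quotient_eq_iff_same_a_r_cos[OF J] by blast
    moreover have "e \<otimes> (x \<ominus> y) \<otimes> e = x \<ominus> y"
      using fixS[OF xy(1)] fixS[OF xy(2)] c e
      by (simp add: a_minus_def l_distr r_distr l_minus r_minus)
    ultimately have "x \<ominus> y = \<zero>" by (rule zero)
    then show "x = y" using c by simp
  qed
  have surj: "(+>) J ` ?S = carrier (quot_alg A J)"
  proof
    show "(+>) J ` ?S \<subseteq> carrier (quot_alg A J)" using car by (auto simp: carrier_quot_alg)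
    show "carrier (quot_alg A J) \<subseteq> (+>) J ` ?S"
    proof
      fix X assume "X \<in> carrier (quot_alg A J)"
      then obtain x where x: "x \<in> carrier A" "X = J +> x" by (auto simp: carrier_quot_alg)
      \<comment> \<open>Peirce decomposition of \<open>x\<close>: the three summands with a factor
        \<open>e'\<close> lie in \<open>J\<close>, so modulo \<open>J\<close> only the corner
        component \<open>e x e\<close> remains.\<close>
      have "x = (e \<oplus> e') \<otimes> x \<otimes> (e \<oplus> e')" using sum1 x by simp
      also have "\<dots> = (e' \<otimes> x \<otimes> e \<oplus> (e \<otimes> x \<otimes> e' \<oplus> e' \<otimes> x \<otimes> e')) \<oplus> e \<otimes> x \<otimes> e"
        using x(1) e e' by (simp add: l_distr r_distr a_ac)
      finally have decomp: "x = (e' \<otimes> x \<otimes> e \<oplus> (e \<otimes> x \<otimes> e' \<oplus> e' \<otimes> x \<otimes> e')) \<oplus> e \<otimes> x \<otimes> e" .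
      have "e' \<otimes> x \<in> J" by (rule J.I_r_closed[OF e'J x(1)])
      then have "e' \<otimes> x \<otimes> e \<in> J" "e' \<otimes> x \<otimes> e' \<in> J" using e e' by (simp_all add: J.I_r_closed)
      moreover have "e \<otimes> x \<otimes> e' \<in> J" using e x(1) by (simp add: J.I_l_closed[OF e'J])
      ultimately have "e' \<otimes> x \<otimes> e \<oplus> (e \<otimes> x \<otimes> e' \<oplus> e' \<otimes> x \<otimes> e') \<in> J" by simp
      with decomp have "x \<in> J +> (e \<otimes> x \<otimes> e)"
        unfolding a_r_coset_def' by blast
      then have "X = J +> (e \<otimes> x \<otimes> e)"
        using x e J.a_repr_independence' by (metis m_closed)
      then show "X \<in> (+>) J ` ?S" using x(1) by (auto simp: S)
    qed
  qed
  \<comment> \<open>The unit of the corner is \<open>e\<close>, not \<open>\<one>\<close>; the two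
    agree modulo \<open>J\<close> because they differ by \<open>e'\<close>.\<close>
  have "e \<in> J +> \<one>"
  proof -
    have "e = \<ominus> e' \<oplus> \<one>" using e e' sum1
      by (metis a_comm a_inv_closed r_neg1)
    then show ?thesis using J.a_inv_closed[OF e'J] by (auto simp: a_r_coset_def')
  qed
  then have one: "J +> e = \<one>\<^bsub>quot_alg A J\<^esub>"
    using J.a_repr_independence' \<pi>.hom_one by (metis one_closed)
  have "(+>) J \<in> ring_iso (corner_alg A e) (quot_alg A J)"
    by (rule ring_iso_memI)
      (use one surj inj car in \<open>auto simp: bij_betw_def corner_alg_def simp del: mem_Collect_eq\<close>)
  moreover have "J +> (c \<odot>\<^bsub>corner_alg A e\<^esub> x) = c \<odot>\<^bsub>quot_alg A J\<^esub> (J +> x)" if "x \<in> ?S" for c x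
    using quot_alg_smult[OF J car[OF that]] by (simp add: corner_alg_def)
  ultimately show "alg_iso (corner_alg A e) (quot_alg A (genideal A {e'}))"
    unfolding alg_iso_def J_def[symmetric] by blast
qed

end


section \<open>Invariance of simple connectedness under isomorphism\<close>

locale k_algebra_iso = A: k_algebra A + B: k_algebra B
  for A :: "('k::field, 'b) module" and B :: "('k, 'c) module" +
  fixes h
  assumes h_iso: "h \<in> ring_iso A B"
    and h_smult: "x \<in> carrier A \<Longrightarrow> h (c \<odot>\<^bsub>A\<^esub> x) = c \<odot>\<^bsub>B\<^esub> h x"

sublocale k_algebra_iso \<subseteq> hom: ring_hom_ring A B h
  using h_iso by unfold_locales (auto simp: ring_iso_def)

context k_algebra_iso
begin

abbreviation g where "g \<equiv> inv_into (carrier A) h"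

lemma h_inj: "inj_on h (carrier A)" and h_surj: "h ` carrier A = carrier B"
  using h_iso by (auto simp: ring_iso_def bij_betw_def)

lemma h_g: "y \<in> carrier B \<Longrightarrow> h (g y) = y"
  and g_closed: "y \<in> carrier B \<Longrightarrow> g y \<in> carrier A"
  and g_h: "x \<in> carrier A \<Longrightarrow> g (h x) = x"
  using h_inj h_surj by (auto simp: f_inv_into_f inv_into_into)

lemma h_eq_iff: "x \<in> carrier A \<Longrightarrow> y \<in> carrier A \<Longrightarrow> h x = h y \<longleftrightarrow> x = y"
  using h_inj by (auto dest: inj_onD)

lemma g_smult: "y \<in> carrier B \<Longrightarrow> g (c \<odot>\<^bsub>B\<^esub> y) = c \<odot>\<^bsub>A\<^esub> g y"
  by (metis A.smult_closed g_closed g_h h_g h_smult)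

text \<open>Interpreting the locale for \<open>g\<close> gives every transfer lemma in the opposite
  direction, which turns inclusions into equalities and implications into equivalences.\<close>

lemma inverse: "k_algebra_iso B A g"
  by (intro k_algebra_iso.intro k_algebra_iso_axioms.intro A.k_algebra_axioms B.k_algebra_axioms
      ring_iso_set_sym[OF A.ring_axioms h_iso] g_smult)

lemma image_g_h: "X \<subseteq> carrier A \<Longrightarrow> g ` h ` X = X"
  and image_h_g: "Y \<subseteq> carrier B \<Longrightarrow> h ` g ` Y = Y"
  by (simp_all add: image_image g_h h_g subset_iff)

lemma idempotent_iff: "x \<in> carrier A \<Longrightarrow> idempotent_of B (h x) \<longleftrightarrow> idempotent_of A x"
  by (simp add: idempotent_of_def h_eq_iff flip: hom.hom_mult)

lemma orthogonal_iff:
  "x \<in> carrier A \<Longrightarrow> y \<in> carrier A \<Longrightarrow> orthogonal_in B (h x) (h y) \<longleftrightarrow> orthogonal_in A x y"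
  by (simp add: orthogonal_in_def h_eq_iff flip: hom.hom_mult hom.hom_zero)

text \<open>An orthogonal decomposition of \<open>h e\<close> in \<open>B\<close> is pulled back
  along \<open>g\<close> to one of \<open>e\<close> in \<open>A\<close>, where one summand must
  vanish.\<close>

lemma primitive_idempotent:
  assumes "primitive_idempotent A e"
  shows "primitive_idempotent B (h e)"
proof -
  have e: "e \<in> carrier A" using assms by (simp add: primitive_idempotent_def idempotent_of_def)
  have "f = \<zero>\<^bsub>B\<^esub> \<or> f' = \<zero>\<^bsub>B\<^esub>"
    if f: "idempotent_of B f" "idempotent_of B f'" "orthogonal_in B f f'" "h e = f \<oplus>\<^bsub>B\<^esub> f'" for f f'
  proof -
    obtain a a' where a: "a \<in> carrier A" "f = h a" "a' \<in> carrier A" "f' = h a'"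
      using f(1,2) by (metis idempotent_of_def h_g g_closed)
    then have "e = a \<oplus>\<^bsub>A\<^esub> a'" using f(4) e by (simp add: h_eq_iff flip: hom.hom_add)
    then have "a = \<zero>\<^bsub>A\<^esub> \<or> a' = \<zero>\<^bsub>A\<^esub>"
      using assms a f(1-3) by (simp add: primitive_idempotent_def idempotent_iff orthogonal_iff)
    then show ?thesis using a by auto
  qed
  then show ?thesis
    using assms e by (auto simp: primitive_idempotent_def idempotent_iff h_eq_iff
        simp flip: hom.hom_zero)
qed

section \<open>Transport of right ideals and of the Jacobson radical\<close>

lemma right_ideal_image:
  assumes "right_ideal J A"
  shows "right_ideal (h ` J) B"
proof -
  interpret J: additive_subgroup J A using assms by (simp add: right_ideal_def)
  have "subgroup (h ` J) (add_monoid B)"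
    by (rule hom.img_is_add_subgroup[OF J.a_subgroup])
  moreover have "h x \<otimes>\<^bsub>B\<^esub> b \<in> h ` J" if "x \<in> J" "b \<in> carrier B" for x b
  proof -
    have "h x \<otimes>\<^bsub>B\<^esub> b = h (x \<otimes>\<^bsub>A\<^esub> g b)" using that by (simp add: h_g g_closed J.a_Hcarr)
    moreover have "x \<otimes>\<^bsub>A\<^esub> g b \<in> J" using assms that g_closed by (simp add: right_ideal_def)
    ultimately show ?thesis by (metis imageI)
  qed
  ultimately show ?thesis by (auto simp: right_ideal_def additive_subgroup_def)
qed

lemma right_ideal_subset: "right_ideal J A \<Longrightarrow> J \<subseteq> carrier A"
  by (simp add: right_ideal_def additive_subgroup.a_subset)

lemma maximal_right_ideal_image:
  assumes M: "maximal_right_ideal M A"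
  shows "maximal_right_ideal (h ` M) B"
proof -
  interpret inv: k_algebra_iso B A g by (rule inverse)
  have MA: "right_ideal M A" using M by (simp add: maximal_right_ideal_def)
  have "J = h ` M \<or> J = carrier B" if J: "right_ideal J B" "h ` M \<subseteq> J" for J
  proof -
    have sub: "J \<subseteq> carrier B" using J(1) by (rule inv.right_ideal_subset)
    have "M \<subseteq> g ` J" using J(2) image_g_h[OF right_ideal_subset[OF MA]] by blast
    then have "g ` J = M \<or> g ` J = carrier A"
      using M inv.right_ideal_image[OF J(1)] by (simp add: maximal_right_ideal_def)
    then show ?thesis using image_h_g[OF sub] h_surj by auto
  qed
  moreover have "h ` M \<noteq> carrier B"
    using M image_g_h[OF right_ideal_subset[OF MA]] image_g_h[of "carrier A"] h_surj
    by (auto simp: maximal_right_ideal_def)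
  ultimately show ?thesis using right_ideal_image[OF MA] by (simp add: maximal_right_ideal_def)
qed

lemma jacobson_radical_subset: "h ` jacobson_radical A \<subseteq> jacobson_radical B"
proof -
  interpret inv: k_algebra_iso B A g by (rule inverse)
  have "h x \<in> M" if x: "x \<in> jacobson_radical A" and M: "maximal_right_ideal M B" for x M
  proof -
    have "x \<in> g ` M"
      using x inv.maximal_right_ideal_image[OF M] by (simp add: jacobson_radical_def)
    moreover have "M \<subseteq> carrier B"
      using M inv.right_ideal_subset by (simp add: maximal_right_ideal_def)
    ultimately show ?thesis using h_g by auto
  qed
  then show ?thesis by (auto simp: jacobson_radical_def)
qed

lemma jacobson_radical_image: "h ` jacobson_radical A = jacobson_radical B"
proof -
  interpret inv: k_algebra_iso B A g by (rule inverse)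
  have "jacobson_radical B \<subseteq> carrier B" by (auto simp: jacobson_radical_def)
  then have "jacobson_radical B = h ` g ` jacobson_radical B" by (simp add: image_h_g)
  also have "\<dots> \<subseteq> h ` jacobson_radical A" by (intro image_mono inv.jacobson_radical_subset)
  finally show ?thesis using jacobson_radical_subset by blast
qed

section \<open>Transport of products and powers of ideals\<close>

lemma ideal_prod_subset:
  assumes "X \<subseteq> carrier A" "Y \<subseteq> carrier A"
  shows "ideal_prod A X Y \<subseteq> carrier A"
proof
  fix x assume "x \<in> ideal_prod A X Y"
  then show "x \<in> carrier A" by induction (use assms in auto)
qed

text \<open>\<open>ideal_prod\<close> is the inductive closure of the products of elements under
  addition; each inclusion is an induction over this construction on its own side.\<close>

lemma ideal_prod_image:
  assumes "X \<subseteq> carrier A" "Y \<subseteq> carrier A"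
  shows "h ` ideal_prod A X Y = ideal_prod B (h ` X) (h ` Y)"
proof (intro equalityI subsetI)
  fix z assume "z \<in> h ` ideal_prod A X Y"
  then obtain x where "x \<in> ideal_prod A X Y" "z = h x" by blast
  moreover from this(1) have "h x \<in> ideal_prod B (h ` X) (h ` Y)"
  proof induction
    case (prod i j)
    then have "h (i \<otimes>\<^bsub>A\<^esub> j) = h i \<otimes>\<^bsub>B\<^esub> h j" using assms by (intro hom.hom_mult) auto
    then show ?case using prod by (auto intro: ideal_prod.prod)
  next
    case (sum s t)
    then have "h (s \<oplus>\<^bsub>A\<^esub> t) = h s \<oplus>\<^bsub>B\<^esub> h t"
      using ideal_prod_subset[OF assms] by (intro hom.hom_add) auto
    then show ?case using sum by (auto intro: ideal_prod.sum)
  qed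
  ultimately show "z \<in> ideal_prod B (h ` X) (h ` Y)" by simp
next
  fix z assume "z \<in> ideal_prod B (h ` X) (h ` Y)"
  then show "z \<in> h ` ideal_prod A X Y"
  proof induction
    case (prod i j)
    then obtain x y where xy: "x \<in> X" "y \<in> Y" "i = h x" "j = h y" by blast
    then have "i \<otimes>\<^bsub>B\<^esub> j = h (x \<otimes>\<^bsub>A\<^esub> y)" using assms by (simp add: subset_iff)
    then show ?case using xy by (auto intro: ideal_prod.prod)
  next
    case (sum s t)
    then obtain x y where xy: "x \<in> ideal_prod A X Y" "y \<in> ideal_prod A X Y" "s = h x" "t = h y"
      by blast
    then have "s \<oplus>\<^bsub>B\<^esub> t = h (x \<oplus>\<^bsub>A\<^esub> y)"
      using ideal_prod_subset[OF assms] by (simp add: subset_iff)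
    then show ?case using xy by (auto intro: ideal_prod.sum)
  qed
qed

lemma ideal_power_subset: "X \<subseteq> carrier A \<Longrightarrow> ideal_power A X n \<subseteq> carrier A"
  by (induction n) (simp_all add: ideal_prod_subset)

lemma ideal_power_image:
  "X \<subseteq> carrier A \<Longrightarrow> h ` ideal_power A X n = ideal_power B (h ` X) n"
  by (induction n) (simp_all add: h_surj ideal_prod_image ideal_power_subset)

section \<open>Transport of projective modules and of the ordinary quiver\<close>

lemma right_proj_iso_image:
  assumes e: "e \<in> carrier A" and f: "f \<in> carrier A" and "right_proj_iso A e f"
  shows "right_proj_iso B (h e) (h f)"
proof -
  let ?P = "(\<lambda>x. e \<otimes>\<^bsub>A\<^esub> x) ` carrier A" and ?R = "(\<lambda>x. f \<otimes>\<^bsub>A\<^esub> x) ` carrier A"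
  have img: "(\<lambda>y. h x \<otimes>\<^bsub>B\<^esub> y) ` carrier B = h ` (\<lambda>y. x \<otimes>\<^bsub>A\<^esub> y) ` carrier A" if "x \<in> carrier A" for x
    using that by (auto simp: image_image simp flip: h_surj)
  have sub: "?P \<subseteq> carrier A" "?R \<subseteq> carrier A" using e f by auto
  from assms(3) obtain \<phi> where bij: "bij_betw \<phi> ?P ?R"
    and add: "\<And>x y. x \<in> ?P \<Longrightarrow> y \<in> ?P \<Longrightarrow> \<phi> (x \<oplus>\<^bsub>A\<^esub> y) = \<phi> x \<oplus>\<^bsub>A\<^esub> \<phi> y"
    and act: "\<And>x a. x \<in> ?P \<Longrightarrow> a \<in> carrier A \<Longrightarrow> \<phi> (x \<otimes>\<^bsub>A\<^esub> a) = \<phi> x \<otimes>\<^bsub>A\<^esub> a"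
    unfolding right_proj_iso_def Let_def by blast
  have cl: "\<phi> x \<in> carrier A" if "x \<in> ?P" for x
    using bij that sub(2) unfolding bij_betw_def by blast
  \<comment> \<open>Conjugating \<open>\<phi>\<close> by \<open>h\<close> gives a map between the
    projectives of \<open>B\<close>; linearity over \<open>B\<close> follows since each scalar in
    \<open>B\<close> has the form \<open>h a\<close>.\<close>
  let ?\<psi> = "\<lambda>y. h (\<phi> (g y))"
  have "bij_betw g (h ` ?P) ?P"
    using sub(1) by (intro bij_betw_byWitness[of _ h]) (auto simp: g_h subset_iff)
  moreover have "bij_betw h ?R (h ` ?R)"
    using h_inj sub(2) by (auto simp: bij_betw_def intro: inj_on_subset)
  ultimately have "bij_betw (h \<circ> (\<phi> \<circ> g)) (h ` ?P) (h ` ?R)"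
    using bij by (blast intro: bij_betw_trans)
  then have "bij_betw ?\<psi> (h ` ?P) (h ` ?R)" by (simp add: comp_def)
  moreover have "?\<psi> (h x \<oplus>\<^bsub>B\<^esub> h y) = ?\<psi> (h x) \<oplus>\<^bsub>B\<^esub> ?\<psi> (h y)" if "x \<in> ?P" "y \<in> ?P" for x y
  proof -
    have "x \<in> carrier A" "y \<in> carrier A" using that sub by auto
    then show ?thesis using cl[OF that(1)] cl[OF that(2)] add[OF that]
      by (simp add: g_h flip: hom.hom_add)
  qed
  moreover have "?\<psi> (h x \<otimes>\<^bsub>B\<^esub> b) = ?\<psi> (h x) \<otimes>\<^bsub>B\<^esub> b" if x: "x \<in> ?P" and b: "b \<in> carrier B" for x b
  proof -
    obtain a where a: "a \<in> carrier A" "b = h a" using b h_surj by auto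
    have "x \<in> carrier A" using x sub by auto
    then show ?thesis using a cl[OF x] act[OF x a(1)]
      by (simp add: g_h flip: hom.hom_mult)
  qed
  ultimately show ?thesis
    unfolding right_proj_iso_def Let_def img[OF e] img[OF f] by blast
qed

lemma right_proj_iso_iff:
  assumes "e \<in> carrier A" "f \<in> carrier A"
  shows "right_proj_iso B (h e) (h f) \<longleftrightarrow> right_proj_iso A e f"
proof -
  interpret inv: k_algebra_iso B A g by (rule inverse)
  show ?thesis
    using right_proj_iso_image[OF assms] inv.right_proj_iso_image[of "h e" "h f"] assms
    by (auto simp: g_h)
qed

text \<open>The same quiver works for \<open>B\<close>, with idempotents and arrow elements replaced
  by their images under \<open>h\<close>. The coefficient functions \<open>c\<close> stay unchanged,
  because \<open>h\<close> carries the radical and its square to those of \<open>B\<close>.\<close>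

lemma ordinary_quiver_image:
  assumes "ordinary_quiver Q A"
  shows "ordinary_quiver Q B"
proof -
  let ?rad = jacobson_radical
  let ?arr = "\<lambda>v w. {\<alpha> \<in> arcs Q. tail Q \<alpha> = v \<and> head Q \<alpha> = w}"
  from assms obtain \<epsilon> \<xi> where fin: "fin_digraph Q"
    and prim: "\<forall>v\<in>verts Q. primitive_idempotent A (\<epsilon> v)"
    and orth: "\<forall>v\<in>verts Q. \<forall>w\<in>verts Q. v \<noteq> w \<longrightarrow> orthogonal_in A (\<epsilon> v) (\<epsilon> w)"
    and one: "(\<Oplus>\<^bsub>A\<^esub>v\<in>verts Q. \<epsilon> v) = \<one>\<^bsub>A\<^esub>"
    and basic: "\<forall>v\<in>verts Q. \<forall>w\<in>verts Q. v \<noteq> w \<longrightarrow> \<not> right_proj_iso A (\<epsilon> v) (\<epsilon> w)"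
    and arrows: "\<forall>v\<in>verts Q. \<forall>w\<in>verts Q.
        (\<forall>\<alpha>\<in>?arr v w. \<xi> \<alpha> \<in> {\<epsilon> v \<otimes>\<^bsub>A\<^esub> r \<otimes>\<^bsub>A\<^esub> \<epsilon> w | r. r \<in> ?rad A}) \<and>
        (\<forall>x\<in>{\<epsilon> v \<otimes>\<^bsub>A\<^esub> r \<otimes>\<^bsub>A\<^esub> \<epsilon> w | r. r \<in> ?rad A}. \<exists>!c. c \<in> ?arr v w \<rightarrow>\<^sub>E UNIV \<and>
          x \<ominus>\<^bsub>A\<^esub> (\<Oplus>\<^bsub>A\<^esub>\<alpha>\<in>?arr v w. c \<alpha> \<odot>\<^bsub>A\<^esub> \<xi> \<alpha>) \<in> ideal_power A (?rad A) 2)"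
    unfolding ordinary_quiver_def Let_def by (elim conjE exE)
  have xi: "\<xi> \<alpha> \<in> {\<epsilon> v \<otimes>\<^bsub>A\<^esub> r \<otimes>\<^bsub>A\<^esub> \<epsilon> w | r. r \<in> ?rad A}"
    if "v \<in> verts Q" "w \<in> verts Q" "\<alpha> \<in> ?arr v w" for v w \<alpha>
    using arrows that by blast
  have basis: "\<exists>!c. c \<in> ?arr v w \<rightarrow>\<^sub>E UNIV \<and>
      x \<ominus>\<^bsub>A\<^esub> (\<Oplus>\<^bsub>A\<^esub>\<alpha>\<in>?arr v w. c \<alpha> \<odot>\<^bsub>A\<^esub> \<xi> \<alpha>) \<in> ideal_power A (?rad A) 2"
    if "v \<in> verts Q" "w \<in> verts Q" "x \<in> {\<epsilon> v \<otimes>\<^bsub>A\<^esub> r \<otimes>\<^bsub>A\<^esub> \<epsilon> w | r. r \<in> ?rad A}" for v w x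
    by (rule arrows[rule_format, OF that(1,2), THEN conjunct2, rule_format, OF that(3)])
  have eps: "\<epsilon> v \<in> carrier A" if "v \<in> verts Q" for v
    using prim that by (simp add: primitive_idempotent_def idempotent_of_def)
  have rad: "?rad A \<subseteq> carrier A" by (auto simp: jacobson_radical_def)
  have piece: "{h (\<epsilon> v) \<otimes>\<^bsub>B\<^esub> r \<otimes>\<^bsub>B\<^esub> h (\<epsilon> w) | r. r \<in> ?rad B} =
      h ` {\<epsilon> v \<otimes>\<^bsub>A\<^esub> r \<otimes>\<^bsub>A\<^esub> \<epsilon> w | r. r \<in> ?rad A}" if v: "v \<in> verts Q" and w: "w \<in> verts Q" for v w
  proof -
    have "h (\<epsilon> v) \<otimes>\<^bsub>B\<^esub> h r \<otimes>\<^bsub>B\<^esub> h (\<epsilon> w) = h (\<epsilon> v \<otimes>\<^bsub>A\<^esub> r \<otimes>\<^bsub>A\<^esub> \<epsilon> w)" if "r \<in> ?rad A" for r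
      using that rad eps[OF v] eps[OF w] by (simp add: subset_iff)
    then show ?thesis by (force simp flip: jacobson_radical_image)
  qed
  have "\<exists>!c. c \<in> ?arr v w \<rightarrow>\<^sub>E UNIV \<and>
      y \<ominus>\<^bsub>B\<^esub> (\<Oplus>\<^bsub>B\<^esub>\<alpha>\<in>?arr v w. c \<alpha> \<odot>\<^bsub>B\<^esub> h (\<xi> \<alpha>)) \<in> ideal_power B (?rad B) 2"
    if v: "v \<in> verts Q" and w: "w \<in> verts Q"
      and y: "y \<in> {h (\<epsilon> v) \<otimes>\<^bsub>B\<^esub> r \<otimes>\<^bsub>B\<^esub> h (\<epsilon> w) | r. r \<in> ?rad B}" for v w y
  proof -
    have sub: "{\<epsilon> v \<otimes>\<^bsub>A\<^esub> r \<otimes>\<^bsub>A\<^esub> \<epsilon> w | r. r \<in> ?rad A} \<subseteq> carrier A"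
      using rad eps[OF v] eps[OF w] by auto
    from y obtain x where x: "x \<in> {\<epsilon> v \<otimes>\<^bsub>A\<^esub> r \<otimes>\<^bsub>A\<^esub> \<epsilon> w | r. r \<in> ?rad A}" "y = h x"
      unfolding piece[OF v w] by blast
    have xc: "x \<in> carrier A" using x(1) sub by blast
    have xic: "\<xi> \<alpha> \<in> carrier A" if "\<alpha> \<in> ?arr v w" for \<alpha> using xi[OF v w that] sub by blast
    \<comment> \<open>The congruence modulo the squared radical is equivalent on both sides for
      every single \<open>c\<close>, so unique existence of \<open>c\<close> passes over
      directly.\<close>
    have "y \<ominus>\<^bsub>B\<^esub> (\<Oplus>\<^bsub>B\<^esub>\<alpha>\<in>?arr v w. c \<alpha> \<odot>\<^bsub>B\<^esub> h (\<xi> \<alpha>)) \<in> ideal_power B (?rad B) 2 \<longleftrightarrow>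
        x \<ominus>\<^bsub>A\<^esub> (\<Oplus>\<^bsub>A\<^esub>\<alpha>\<in>?arr v w. c \<alpha> \<odot>\<^bsub>A\<^esub> \<xi> \<alpha>) \<in> ideal_power A (?rad A) 2" for c
    proof -
      let ?s = "\<Oplus>\<^bsub>A\<^esub>\<alpha>\<in>?arr v w. c \<alpha> \<odot>\<^bsub>A\<^esub> \<xi> \<alpha>"
      have sc: "?s \<in> carrier A" using xic by (intro A.finsum_closed) auto
      have "h ?s = (\<Oplus>\<^bsub>B\<^esub>\<alpha>\<in>?arr v w. h (c \<alpha> \<odot>\<^bsub>A\<^esub> \<xi> \<alpha>))"
        using xic by (subst hom.hom_finsum) (auto simp: comp_def)
      also have "\<dots> = (\<Oplus>\<^bsub>B\<^esub>\<alpha>\<in>?arr v w. c \<alpha> \<odot>\<^bsub>B\<^esub> h (\<xi> \<alpha>))"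
        using xic by (intro B.finsum_cong') (auto simp: h_smult)
      finally have "y \<ominus>\<^bsub>B\<^esub> (\<Oplus>\<^bsub>B\<^esub>\<alpha>\<in>?arr v w. c \<alpha> \<odot>\<^bsub>B\<^esub> h (\<xi> \<alpha>)) = h (x \<ominus>\<^bsub>A\<^esub> ?s)"
        using x(2) xc sc by (simp add: a_minus_def)
      moreover have "ideal_power B (?rad B) 2 = h ` ideal_power A (?rad A) 2"
        using ideal_power_image[OF rad] by (simp add: jacobson_radical_image)
      moreover have "h (x \<ominus>\<^bsub>A\<^esub> ?s) \<in> h ` ideal_power A (?rad A) 2 \<longleftrightarrow>
          x \<ominus>\<^bsub>A\<^esub> ?s \<in> ideal_power A (?rad A) 2"
        using xc sc by (intro inj_on_image_mem_iff[OF h_inj] ideal_power_subset[OF rad]) simp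
      ultimately show ?thesis by simp
    qed
    then show ?thesis using basis[OF v w x(1)] by simp
  qed
  moreover have "(\<Oplus>\<^bsub>B\<^esub>v\<in>verts Q. h (\<epsilon> v)) = \<one>\<^bsub>B\<^esub>"
    using one eps hom.hom_finsum[of \<epsilon> "verts Q"] by (auto simp: comp_def Pi_def)
  moreover have "h (\<xi> \<alpha>) \<in> {h (\<epsilon> v) \<otimes>\<^bsub>B\<^esub> r \<otimes>\<^bsub>B\<^esub> h (\<epsilon> w) | r. r \<in> ?rad B}"
    if "v \<in> verts Q" "w \<in> verts Q" "\<alpha> \<in> ?arr v w" for v w \<alpha>
    unfolding piece[OF that(1,2)] by (rule imageI[OF xi[OF that]])
  moreover have "orthogonal_in B (h (\<epsilon> v)) (h (\<epsilon> w))" "\<not> right_proj_iso B (h (\<epsilon> v)) (h (\<epsilon> w))"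
    if "v \<in> verts Q" "w \<in> verts Q" "v \<noteq> w" for v w
    using orth basic that eps by (simp_all add: orthogonal_iff right_proj_iso_iff)
  moreover have "primitive_idempotent B (h (\<epsilon> v))" if "v \<in> verts Q" for v
    using prim that by (simp add: primitive_idempotent)
  ultimately show ?thesis
    unfolding ordinary_quiver_def Let_def
    by (intro conjI exI[of _ "\<lambda>v. h (\<epsilon> v)"] exI[of _ "\<lambda>\<alpha>. h (\<xi> \<alpha>)"] ballI impI fin)
qed

end

lemma alg_iso_trans:
  assumes "alg_iso A B" "alg_iso B C"
  shows "alg_iso A C"
proof -
  from assms obtain h k where h: "h \<in> ring_iso A B" "\<And>c x. x \<in> carrier A \<Longrightarrow> h (c \<odot>\<^bsub>A\<^esub> x) = c \<odot>\<^bsub>B\<^esub> h x"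
    and k: "k \<in> ring_iso B C" "\<And>c x. x \<in> carrier B \<Longrightarrow> k (c \<odot>\<^bsub>B\<^esub> x) = c \<odot>\<^bsub>C\<^esub> k x"
    unfolding alg_iso_def by blast
  then show ?thesis
    unfolding alg_iso_def
    by (intro bexI[of _ "k \<circ> h"]) (auto simp: ring_iso_memE(1) intro: ring_iso_set_trans)
qed

text \<open>The two halves of the definition travel in opposite directions: an acyclic ordinary
  quiver of \<open>A\<close> is carried to \<open>B\<close> by \<open>h\<close>, while a
  presentation of \<open>B\<close> becomes one of \<open>A\<close> through \<open>g\<close> and
  composition with \<open>iso\<close>. The fundamental group depends only on \<open>Q\<close> and
  \<open>I\<close>.\<close>

lemma simply_connected_alg_iso:
  assumes "k_algebra A" "k_algebra B" and iso: "alg_iso A B" and sc: "simply_connected A"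
  shows "simply_connected B"
proof -
  from iso obtain h where h: "h \<in> ring_iso A B"
      "\<And>c x. x \<in> carrier A \<Longrightarrow> h (c \<odot>\<^bsub>A\<^esub> x) = c \<odot>\<^bsub>B\<^esub> h x"
    unfolding alg_iso_def by blast
  interpret h: k_algebra_iso A B h
    using assms(1,2) h by (intro k_algebra_iso.intro k_algebra_iso_axioms.intro)
  interpret inv: k_algebra_iso B A h.g by (rule h.inverse)
  have "presentation Q I A" if "presentation Q I B" for Q :: "(nat, nat) pre_digraph" and I
    using that inv.ordinary_quiver_image alg_iso_trans[OF iso] by (auto simp: presentation_def)
  then show ?thesis
    using sc h.ordinary_quiver_image unfolding simply_connected_def by blast
qed


section \<open>Vertex idempotents of the path algebra\<close>

text \<open>A closed form, inside the path algebra, of a representative of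
  \<open>vertex_idem\<close>. It lets products be studied on coefficient functions before passing to
  the quotient by \<open>I\<close>.\<close>

definition trivial_paths :: "'v set \<Rightarrow> ('v, 'a) qpath \<Rightarrow> 'k::field" where
  "trivial_paths V \<tau> = (if \<exists>v\<in>V. \<tau> = (v, [], v) then 1 else 0)"

lemma carrier_path_algebra:
  "carrier (path_algebra Q) = {f. finite {\<pi>. f \<pi> \<noteq> 0} \<and> {\<pi>. f \<pi> \<noteq> 0} \<subseteq> qpaths Q}"
  by (simp add: path_algebra_def)

lemma zero_path_algebra: "\<zero>\<^bsub>path_algebra Q\<^esub> = (\<lambda>\<tau>. 0)"
  by (simp add: path_algebra_def)

lemma basis_path_trivial: "basis_path (v, [], v) = trivial_paths {v}"
  by (auto simp: basis_path_def trivial_paths_def)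

text \<open>A nonzero coefficient is a nonzero sum over factorisations, so some summand is nonzero.
  The later vanishing statements become arguments about supports of paths.\<close>

lemma path_algebra_mult_nonzero:
  fixes f g :: "('v, 'a) qpath \<Rightarrow> 'k::field"
  assumes "(f \<otimes>\<^bsub>path_algebra Q\<^esub> g) \<tau> \<noteq> 0"
  obtains \<pi> \<rho> where "\<pi> \<in> qpaths Q" "\<rho> \<in> qpaths Q" "trg \<pi> = src \<rho>" "pcomp \<pi> \<rho> = \<tau>" "f \<pi> \<noteq> 0" "g \<rho> \<noteq> 0"
proof -
  let ?S = "{(\<pi>, \<rho>). \<pi> \<in> qpaths Q \<and> \<rho> \<in> qpaths Q \<and> trg \<pi> = src \<rho> \<and> pcomp \<pi> \<rho> = \<tau>}"
  have "(\<Sum>(\<pi>, \<rho>)\<in>?S. f \<pi> * g \<rho>) \<noteq> 0" using assms by (simp add: path_algebra_def)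
  then obtain z where "z \<in> ?S" "(case z of (\<pi>, \<rho>) \<Rightarrow> f \<pi> * g \<rho>) \<noteq> 0"
    by (rule sum.not_neutral_contains_not_neutral)
  then show ?thesis by (intro that[of "fst z" "snd z"]) (auto split: prod.splits)
qed

text \<open>The ring axioms enter as a premise because \<open>ideal I (path_algebra Q)\<close>
  already contains them; what remains are the scalar laws, checked coefficientwise.\<close>

lemma k_algebra_path_algebra:
  assumes "ring (path_algebra Q :: ('k::field, _) module)"
  shows "k_algebra (path_algebra Q :: ('k, _) module)"
proof (intro k_algebra.intro k_algebra_axioms.intro assms)
  fix f :: "_ \<Rightarrow> 'k" and c :: 'k assume "f \<in> carrier (path_algebra Q)"
  moreover have "{\<pi>. c * f \<pi> \<noteq> 0} \<subseteq> {\<pi>. f \<pi> \<noteq> 0}" by auto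
  ultimately show "c \<odot>\<^bsub>path_algebra Q\<^esub> f \<in> carrier (path_algebra Q)"
    by (auto simp: path_algebra_def intro: finite_subset)
qed (auto simp: path_algebra_def fun_eq_iff algebra_simps sum_distrib_left split_beta)

lemma trivial_paths_closed:
  fixes Q :: "('v, 'a) pre_digraph"
  assumes "finite V" "V \<subseteq> verts Q"
  shows "(trivial_paths V :: _ \<Rightarrow> 'k::field) \<in> carrier (path_algebra Q)"
proof -
  have "{\<pi> :: ('v, 'a) qpath. trivial_paths V \<pi> \<noteq> (0 :: 'k)} = (\<lambda>v. (v, [], v)) ` V"
    by (auto simp: trivial_paths_def)
  then show ?thesis using assms
    by (auto simp: carrier_path_algebra qpaths_def pre_digraph.awalk_def pre_digraph.cas.simps)
qed

lemma trivial_paths_disjoint: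
  assumes "V \<inter> W = {}"
  shows "trivial_paths V \<otimes>\<^bsub>path_algebra Q\<^esub> trivial_paths W = \<zero>\<^bsub>path_algebra Q\<^esub>"
    (is "?p = _")
proof -
  have "?p \<tau> = 0" for \<tau>
  proof (rule ccontr)
    assume "?p \<tau> \<noteq> 0"
    then show False using assms
      by (elim path_algebra_mult_nonzero) (auto simp: trivial_paths_def src_def trg_def split: if_splits)
  qed
  then show ?thesis by (simp add: zero_path_algebra fun_eq_iff)
qed

text \<open>Composing with a trivial path changes nothing, so the factor supported on trivial paths
  fixes the corresponding endpoint of the product path.\<close>

lemma trivial_paths_mult_nonzero:
  "(trivial_paths V \<otimes>\<^bsub>path_algebra Q\<^esub> f) \<tau> \<noteq> 0 \<Longrightarrow> src \<tau> \<in> V"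
  "(f \<otimes>\<^bsub>path_algebra Q\<^esub> trivial_paths V) \<tau> \<noteq> 0 \<Longrightarrow> trg \<tau> \<in> V"
  by (erule path_algebra_mult_nonzero;
      force simp: trivial_paths_def src_def trg_def pcomp_def split: if_splits)+

lemma finsum_basis_path:
  assumes "ring (path_algebra Q :: ('k::field, _) module)" "finite V" "V \<subseteq> verts Q"
  shows "(\<Oplus>\<^bsub>path_algebra Q\<^esub>v\<in>V. basis_path (v, [], v) :: _ \<Rightarrow> 'k) = trivial_paths V"
proof -
  interpret P: ring "path_algebra Q :: ('k, _) module" by fact
  show ?thesis unfolding basis_path_trivial using assms(2,3)
  proof (induction V)
    case empty
    then show ?case by (simp add: zero_path_algebra trivial_paths_def fun_eq_iff)
  next
    case (insert v V)
    then have "(\<Oplus>\<^bsub>path_algebra Q\<^esub>v\<in>insert v V. trivial_paths {v} :: _ \<Rightarrow> 'k) =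
        trivial_paths {v} \<oplus>\<^bsub>path_algebra Q\<^esub> trivial_paths V"
      by (subst P.finsum_insert) (auto intro!: trivial_paths_closed)
    also have "\<dots> = trivial_paths (insert v V)"
      using insert.hyps(2) by (auto simp: path_algebra_def trivial_paths_def fun_eq_iff)
    finally show ?case .
  qed
qed

text \<open>The quotient map commutes with finite sums, so the sum of the classes is the class of
  the sum.\<close>

lemma vertex_idem_eq:
  assumes "ideal I (path_algebra Q :: ('k::field, _) module)" "finite V" "V \<subseteq> verts Q"
  shows "vertex_idem Q I V = I +>\<^bsub>path_algebra Q\<^esub> (trivial_paths V :: _ \<Rightarrow> 'k)"
proof -
  let ?P = "path_algebra Q :: ('k, _) module"
  interpret ideal I ?P by fact
  interpret \<pi>: ring_hom_ring ?P "quot_alg ?P I" "(+>\<^bsub>?P\<^esub>) I"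
    by (rule rcos_ring_hom_quot_alg[OF assms(1)])
  have "basis_path (v, [], v) \<in> carrier ?P" if "v \<in> V" for v
    unfolding basis_path_trivial using that assms(3) by (intro trivial_paths_closed) auto
  then show ?thesis
    unfolding vertex_idem_def bound_quiver_algebra_def
    using \<pi>.hom_finsum[of "\<lambda>v. basis_path (v, [], v)" V]
      finsum_basis_path[OF ring_axioms assms(2,3)]
    by (auto simp: comp_def Pi_def)
qed

text \<open>A path in the support would start in \<open>C\<close>, visit a vertex outside
  \<open>C\<close> and end in \<open>C\<close>, against convexity. The product thus vanishes already
  in the path algebra, whatever \<open>I\<close> is.\<close>

lemma convex_corner_zero:
  assumes C: "full_convex_subquiver C Q"
  shows "(trivial_paths (verts C) \<otimes>\<^bsub>path_algebra Q\<^esub> f) \<otimes>\<^bsub>path_algebra Q\<^esub>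
      (trivial_paths (verts Q - verts C) \<otimes>\<^bsub>path_algebra Q\<^esub>
        (g \<otimes>\<^bsub>path_algebra Q\<^esub> trivial_paths (verts C))) = \<zero>\<^bsub>path_algebra Q\<^esub>"
    (is "?f \<otimes>\<^bsub>?P\<^esub> (?e' \<otimes>\<^bsub>?P\<^esub> ?g) = _")
proof -
  have wf: "wf_digraph Q" and sub: "verts C \<subseteq> verts Q"
    using C by (auto simp: full_convex_subquiver_def)
  interpret wf_digraph Q by fact
  have "(?f \<otimes>\<^bsub>?P\<^esub> (?e' \<otimes>\<^bsub>?P\<^esub> ?g)) \<tau> = 0" for \<tau>
  proof (rule ccontr)
    assume "(?f \<otimes>\<^bsub>?P\<^esub> (?e' \<otimes>\<^bsub>?P\<^esub> ?g)) \<tau> \<noteq> 0"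
    then obtain \<pi> \<rho> where p: "\<pi> \<in> qpaths Q" "\<rho> \<in> qpaths Q" "trg \<pi> = src \<rho>"
      and f: "?f \<pi> \<noteq> 0" and g: "(?e' \<otimes>\<^bsub>?P\<^esub> ?g) \<rho> \<noteq> 0"
      by (rule path_algebra_mult_nonzero)
    have s: "src \<pi> \<in> verts C" "src \<rho> \<notin> verts C"
      using f g trivial_paths_mult_nonzero(1) by blast+
    \<comment> \<open>A second factorisation is needed for the end of \<open>\<rho>\<close>: its
      last piece \<open>\<rho>'\<close> lies in the support of \<open>?g\<close>, whose paths end in
      \<open>C\<close>.\<close>
    from g obtain \<sigma> \<rho>' where "pcomp \<sigma> \<rho>' = \<rho>" "?g \<rho>' \<noteq> 0"
      by (rule path_algebra_mult_nonzero)
    then have "trg \<rho>' \<in> verts C" "trg \<rho> = trg \<rho>'"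
      by (blast dest: trivial_paths_mult_nonzero(2), auto simp: pcomp_def trg_def)
    then have t: "trg \<rho> \<in> verts C" by simp
    obtain u p v q w where eq: "\<pi> = (u, p, v)" "\<rho> = (v, q, w)"
      using p(3) by (cases \<pi>, cases \<rho>) (auto simp: src_def trg_def)
    have pq: "awalk u p v" "awalk v q w" using p eq by (auto simp: qpaths_def)
    then have "awalk u (p @ q) w" by (rule awalk_appendI)
    \<comment> \<open>The junction \<open>v\<close> is the last vertex of the first piece; it is the
      vertex of the composite that leaves \<open>C\<close>.\<close>
    moreover have "v \<in> set (awalk_verts u (p @ q))"
      using pq awalk_verts_append[OF \<open>awalk u (p @ q) w\<close>] awlast_if_cas
      by (metis Un_iff awalk_def awalk_verts_non_Nil last_in_set set_append)
    moreover have "u \<in> verts C" "v \<notin> verts C" "w \<in> verts C"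
      using s t eq by (auto simp: src_def trg_def)
    ultimately show False
      using C unfolding full_convex_subquiver_def by blast
  qed
  then show ?thesis by (simp add: zero_path_algebra fun_eq_iff)
qed

text \<open>The premises of \<open>corner_iso_quotient\<close> are verified on representatives in
  the path algebra and pushed to the bound quiver algebra by the quotient homomorphism. Then
  \<open>simply_connected_alg_iso\<close> carries simple connectedness from the corner to the
  quotient.\<close>

theorem theorem1p2:
  fixes Q C :: "('v, 'a) pre_digraph"
    and I :: "(('v, 'a) qpath \<Rightarrow> 'k::alg_closed_field) set"
  assumes "fin_digraph Q"
    and "ideal I (path_algebra Q)"
    and "fin_dim (bound_quiver_algebra Q I)"
    and "full_convex_subquiver C Q"
    and "strongly_simply_connected Q I"
  shows "simply_connected
    (quot_alg (bound_quiver_algebra Q I)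
      (genideal (bound_quiver_algebra Q I) {vertex_idem Q I (verts Q - verts C)}))"
proof -
  let ?P = "path_algebra Q :: ('k, ('v, 'a) qpath \<Rightarrow> 'k) module"
  let ?L = "bound_quiver_algebra Q I"
  let ?t = "trivial_paths (verts C) :: ('v, 'a) qpath \<Rightarrow> 'k"
  let ?t' = "trivial_paths (verts Q - verts C) :: ('v, 'a) qpath \<Rightarrow> 'k"
  let ?e = "vertex_idem Q I (verts C)" and ?e' = "vertex_idem Q I (verts Q - verts C)"
  interpret fin_digraph Q by fact
  interpret I: ideal I ?P by fact
  interpret P: k_algebra ?P by (rule k_algebra_path_algebra[OF I.ring_axioms])
  interpret L: k_algebra ?L
    unfolding bound_quiver_algebra_def by (rule P.quot_alg_k_algebra[OF assms(2)])
  interpret \<pi>: ring_hom_ring ?P ?L "(+>\<^bsub>?P\<^esub>) I"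
    unfolding bound_quiver_algebra_def by (rule rcos_ring_hom_quot_alg[OF assms(2)])
  have sub: "verts C \<subseteq> verts Q" using assms(4) by (auto simp: full_convex_subquiver_def)
  then have fin: "finite (verts C)" by (rule finite_subset) simp
  have t: "?t \<in> carrier ?P" and t': "?t' \<in> carrier ?P"
    using sub fin by (auto intro!: trivial_paths_closed)
  have e: "?e = I +>\<^bsub>?P\<^esub> ?t" and e': "?e' = I +>\<^bsub>?P\<^esub> ?t'"
    using sub fin vertex_idem_eq[OF assms(2)] by simp_all
  \<comment> \<open>The two vertex sets partition \<open>verts Q\<close>, and the unit of the path
    algebra is the sum of all trivial paths.\<close>
  have sum1: "?t \<oplus>\<^bsub>?P\<^esub> ?t' = \<one>\<^bsub>?P\<^esub>"
    using sub by (auto simp: path_algebra_def trivial_paths_def fun_eq_iff)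
  have L: "carrier ?L = (\<lambda>x. I +>\<^bsub>?P\<^esub> x) ` carrier ?P"
    unfolding bound_quiver_algebra_def by (rule carrier_quot_alg)
  have orth: "(?e \<otimes>\<^bsub>?L\<^esub> x) \<otimes>\<^bsub>?L\<^esub> (?e' \<otimes>\<^bsub>?L\<^esub> (y \<otimes>\<^bsub>?L\<^esub> ?e)) = \<zero>\<^bsub>?L\<^esub>"
    if xy: "x \<in> carrier ?L" "y \<in> carrier ?L" for x y
  proof -
    \<comment> \<open>Convexity is a statement about paths, so \<open>x\<close> and \<open>y\<close>
      are lifted to elements \<open>f\<close> and \<open>g\<close> of the path algebra.\<close>
    from xy obtain f g where "f \<in> carrier ?P" "x = I +>\<^bsub>?P\<^esub> f" "g \<in> carrier ?P" "y = I +>\<^bsub>?P\<^esub> g"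
      unfolding L by blast
    then show ?thesis unfolding e e' using t t' convex_corner_zero[OF assms(4), of f g]
      by (simp flip: \<pi>.hom_mult)
  qed
  have one: "?e \<oplus>\<^bsub>?L\<^esub> ?e' = \<one>\<^bsub>?L\<^esub>"
    unfolding e e' using t t' sum1 by (simp flip: \<pi>.hom_add)
  have zero: "?e \<otimes>\<^bsub>?L\<^esub> ?e' = \<zero>\<^bsub>?L\<^esub>"
  proof -
    have "?t \<otimes>\<^bsub>?P\<^esub> ?t' = \<zero>\<^bsub>?P\<^esub>" by (rule trivial_paths_disjoint) blast
    then show ?thesis unfolding e e' using t t' by (simp flip: \<pi>.hom_mult)
  qed
  have closed: "?e \<in> carrier ?L" "?e' \<in> carrier ?L" using t t' by (auto simp: e e')
  note iso = L.corner_iso_quotient[OF closed one zero orth]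
  have "k_algebra (quot_alg ?L (genideal ?L {?e'}))"
    using closed(2) by (intro L.quot_alg_k_algebra L.genideal_ideal) auto
  \<comment> \<open>Strong simple connectedness is used for the subquiver \<open>D = C\<close>
    itself.\<close>
  moreover have "simply_connected (corner_alg ?L ?e)"
    using assms(4,5) by (auto simp: strongly_simply_connected_def)
  ultimately show ?thesis
    using iso simply_connected_alg_iso by blast
qed

end
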